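(* Let $\{g_n\}_{n=0}^{\infty}$ be a non-trivial non-negative log-concave sequence without internal zeros. Then the function $$\mu\mapsto g(\mu,x)=\sum_{n=0}^{\infty}\frac{g_n x^n}{\Gamma(\mu+n)}$$ is strictly discrete Wright log-concave on $(0,\infty)$ for each fixed $x\ge 0$. Moreover, for all real $\mu,\beta$ with $\mu\ge-1$, $\beta>0$ and $\mu+\beta\ge0$, the function $$\lambda_{\beta,\mu}(x):=g(\mu+1,x)g(\mu+\beta,x)-g(\mu,x)g(\mu+\beta+1,x)=\sum_{m=0}^{\infty}\lambda_m x^m$$ has positive power series coefficients, $\lambda_m>0$ for all $m\ge0$. This implies that $x\mapsto\lambda_{\beta,\mu}(x)$ is absolutely monotonic and multiplicatively convex on $(0,\infty)$.
   Context: $\Gamma$ is Euler's gamma function and $1/\Gamma$ is regarded as an entire function (equal to $0$ at $0,-1,-2,\ldots$). Power series in $x$ are understood as formal power series as far as coefficients are concerned. A non-negative sequence $\{g_n\}_{n\ge0}$ is log-concave if $g_k^2\ge g_{k-1}g_{k+1}$ for all $k\ge1$; it is non-trivial if it is not identically zero; it has no internal zeros if $g_N=0$ implies $g_{N+i}=0$ for all integers $i\ge 0$. A positive continuous function $F$ on an interval $I$ is discrete Wright log-concave if $F(\mu+h)F(\mu+s)-F(\mu)F(\mu+h+s)\ge0$ for all positive integers $h$, all real $s>0$ and all $\mu$ such that all arguments lie in $I$; it is strictly so if the inequality is strict. A function is absolutely monotonic on $(0,\infty)$ if it and all its derivatives are non-negative there. A function $\varphi$ is multiplicatively convex on $(0,\infty)$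 if $\varphi(x^{\lambda}y^{1-\lambda})\le\varphi(x)^{\lambda}\varphi(y)^{1-\lambda}$ for all $x,y>0$ and $\lambda\in[0,1]$.
   Formalization: λ_m>0 for all m fails for g=(1,0,0,…) and, since λ_0=0, at μ=-1; proved instead: λ_m≥0 always, and λ_m>0 if some g_k g_{m-k}≠0 (k≤m) and either μ>-1, or μ=-1 with β≠1 and m>0. *)

theory Defs
  imports "HOL-Analysis.Analysis" "HOL-Computational_Algebra.Formal_Power_Series"
begin

definition log_concave_seq :: "(nat \<Rightarrow> real) \<Rightarrow> bool" where
  "log_concave_seq g \<longleftrightarrow> (\<forall>k\<ge>1. (g k)\<^sup>2 \<ge> g (k - 1) * g (k + 1))"

definition no_internal_zeros :: "(nat \<Rightarrow> real) \<Rightarrow> bool" where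
  "no_internal_zeros g \<longleftrightarrow> (\<forall>N. g N = 0 \<longrightarrow> (\<forall>i. g (N + i) = 0))"

definition strictly_discrete_Wright_log_concave_on :: "real set \<Rightarrow> (real \<Rightarrow> real) \<Rightarrow> bool" where
  "strictly_discrete_Wright_log_concave_on I F \<longleftrightarrow>
     (\<forall>\<mu>\<in>I. F \<mu> > 0) \<and> continuous_on I F \<and>
     (\<forall>(h::nat) s \<mu>. h > 0 \<longrightarrow> s > 0 \<longrightarrow>
        \<mu> \<in> I \<longrightarrow> \<mu> + real h \<in> I \<longrightarrow> \<mu> + s \<in> I \<longrightarrow> \<mu> + real h + s \<in> I \<longrightarrow>
        F (\<mu> + real h) * F (\<mu> + s) - F \<mu> * F (\<mu> + real h + s) > 0)"

(* The value of deriv is arbitrary where no derivative exists, so the existence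
   of every iterated derivative is required explicitly. *)
definition absolutely_monotonic :: "(real \<Rightarrow> real) \<Rightarrow> bool" where
  "absolutely_monotonic f \<longleftrightarrow>
     (\<forall>k. \<forall>x>0. ((deriv ^^ k) f) differentiable (at x) \<and> (deriv ^^ k) f x \<ge> 0)"

(* Non-negativity is required because powr is only meaningful for non-negative bases.
   The library has 0 powr 0 = 0 rather than 1; this does not change the class of functions:
   if f x = 0 for some x > 0, the inequality with 0 < t < 1 already forces f to vanish
   on all of (0, infinity), and then both sides are 0 for t = 0 and t = 1 as well. *)
definition multiplicatively_convex :: "(real \<Rightarrow> real) \<Rightarrow> bool" where
  "multiplicatively_convex f \<longleftrightarrow>
     (\<forall>x>0. f x \<ge> 0) \<and>
     (\<forall>x>0. \<forall>y>0. \<forall>t\<in>{0..1}.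
        f (x powr t * y powr (1 - t)) \<le> f x powr t * f y powr (1 - t))"

(* rGamma is the entire function 1 / Gamma, with rGamma (-n) = 0 for natural n. *)
definition recip_gamma_sum :: "(nat \<Rightarrow> real) \<Rightarrow> real \<Rightarrow> real \<Rightarrow> real" where
  "recip_gamma_sum g \<mu> x = (\<Sum>n. g n * x ^ n * rGamma (\<mu> + real n))"

definition recip_gamma_fps :: "(nat \<Rightarrow> real) \<Rightarrow> real \<Rightarrow> real fps" where
  "recip_gamma_fps g \<mu> = Abs_fps (\<lambda>n. g n * rGamma (\<mu> + real n))"

definition lam :: "(nat \<Rightarrow> real) \<Rightarrow> real \<Rightarrow> real \<Rightarrow> real \<Rightarrow> real" where
  "lam g \<beta> \<mu> x =
     recip_gamma_sum g (\<mu> + 1) x * recip_gamma_sum g (\<mu> + \<beta>) x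
     - recip_gamma_sum g \<mu> x * recip_gamma_sum g (\<mu> + \<beta> + 1) x"

(* Coefficientwise positivity of lam_fps for mu >= -1, beta > 0, mu + beta >= 0 has
   unavoidable exceptions:
   - if g has finite support, the coefficient of order m vanishes for large m;
   - if mu = -1, the coefficient of order 0, which is
     beta * (g 0)^2 * rGamma (mu + 1) * rGamma (mu + beta + 1), vanishes;
   - if mu = -1, beta = 1 and g is constant, all coefficients vanish
     (the three sums involved are x^2 * exp x, x * exp x and exp x). *)
definition lam_fps :: "(nat \<Rightarrow> real) \<Rightarrow> real \<Rightarrow> real \<Rightarrow> real fps" where
  "lam_fps g \<beta> \<mu> =
     recip_gamma_fps g (\<mu> + 1) * recip_gamma_fps g (\<mu> + \<beta>)
     - recip_gamma_fps g \<mu> * recip_gamma_fps g (\<mu> + \<beta> + 1)"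

end

theory Submission
  imports Defs
begin

text \<open>
  Put \<open>N = m + 1\<close> and \<open>U k = 1 / (\<Gamma>(\<mu> + k) \<Gamma>(\<mu> + \<beta> + N - k))\<close>.  The coefficient of order \<open>m\<close> of
  \<open>\<lambda>\<^sub>\<beta>\<^sub>,\<^sub>\<mu>\<close> is the sum of \<open>g k * g (m - k) * (U (k + 1) - U k)\<close> over \<open>k \<le> m\<close>.  The weights
  \<open>g k * g (m - k)\<close> are symmetric and, by log-concavity, increase up to the middle.  Summation by
  parts followed by the reflection \<open>k \<mapsto> N - k\<close> therefore turns twice the coefficient into a sum
  of products of a weight increment with \<open>U (N - k) - U k\<close>, and both factors are non-negative for
  \<open>2 k < N\<close>, because \<open>U k \<le> U (N - k)\<close> amounts to the monotonicity of the rising factorial.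
  The first non-zero weight gives a strictly positive term.  The Wright property for \<open>h = 1\<close> is
  the positivity of \<open>\<lambda>\<^sub>\<beta>\<^sub>,\<^sub>\<mu>\<close> at \<open>x \<ge> 0\<close>, and larger \<open>h\<close> follow by induction.
\<close>

section \<open>Summation by parts for symmetric weights\<close>

text \<open>Abel summation has no boundary term since symmetry gives
  \<open>e (Suc N) = e 0 = 0\<close>. The increments of \<open>e\<close> change sign under
  \<open>k \<mapsto> N - k\<close>, so averaging the sum with its reflection produces the difference
  \<open>U (N - k) - U k\<close>.\<close>

lemma symmetric_summation_by_parts:
  fixes e U :: "nat \<Rightarrow> real"
  assumes e0: "e 0 = 0" and sym: "\<And>k. k \<le> Suc N \<Longrightarrow> e (Suc N - k) = e k"
  shows "2 * (\<Sum>k<N. e (Suc k) * (U (Suc k) - U k)) = (\<Sum>k\<le>N. (e (Suc k) - e k) * (U (N - k) - U k))"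
proof -
  have parts: "(\<Sum>k<n. e (Suc k) * (U (Suc k) - U k)) = e (Suc n) * U n - (\<Sum>k\<le>n. (e (Suc k) - e k) * U k)" for n
    by (induction n) (simp_all add: e0 algebra_simps)
  have eN: "e (Suc N) = 0" using sym[of 0] e0 by simp
  have "(\<Sum>k\<le>N. (e (Suc k) - e k) * U (N - k)) = (\<Sum>k\<le>N. (e k - e (Suc k)) * U k)"
  proof (rule sum.reindex_bij_witness[of _ "\<lambda>k. N - k" "\<lambda>k. N - k"])
    fix k assume "k \<in> {..N}"
    then show "(e (N - k) - e (Suc (N - k))) * U (N - k) = (e (Suc k) - e k) * U (N - k)"
      using sym[of k] sym[of "Suc k"] by (simp add: Suc_diff_le)
  qed auto
  also have "\<dots> = - (\<Sum>k\<le>N. (e (Suc k) - e k) * U k)"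
    by (simp add: sum_negf[symmetric] algebra_simps)
  finally have "(\<Sum>k\<le>N. (e (Suc k) - e k) * (U (N - k) - U k)) = - 2 * (\<Sum>k\<le>N. (e (Suc k) - e k) * U k)"
    by (simp add: right_diff_distrib[of "e (Suc _) - e _"] sum_subtractf)
  then show ?thesis using parts[of N] unfolding eN by linarith
qed

section \<open>Rising factorials and products of reciprocal gamma values\<close>

text \<open>Only the first factor of \<open>pochhammer a n\<close> can be negative, so it is split
  off: for \<open>a \<ge> 0\<close> the factors are compared one by one, and for
  \<open>a < 0\<close> the two sides are separated by 0. In the case \<open>a = -1\<close>,
  \<open>b = 0\<close> both sides vanish once \<open>n \<ge> 2\<close>.\<close>

lemma pochhammer_mono_ge_minus_one:
  fixes a b :: real
  assumes a: "a \<ge> -1" and ab: "a < b" and b: "b \<ge> 0" and n: "n > 0"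
  shows "pochhammer a n \<le> pochhammer b n"
    and "a > -1 \<or> b > 0 \<Longrightarrow> pochhammer a n < pochhammer b n"
proof -
  obtain p where p: "n = Suc p" using n by (cases n) auto
  define P Q where "P = pochhammer (a + 1) p" and "Q = pochhammer (b + 1) p"
  have eqs: "pochhammer a n = a * P" "pochhammer b n = b * Q"
    by (simp_all add: p P_def Q_def pochhammer_rec)
  have P0: "P \<ge> 0" and PQ: "P \<le> Q" unfolding P_def Q_def pochhammer_prod
    using a ab by (auto intro!: prod_nonneg prod_mono)
  have Q0: "Q > 0" unfolding Q_def using b by (intro pochhammer_pos) auto
  have P1: "a > -1 \<Longrightarrow> P > 0" unfolding P_def by (intro pochhammer_pos) auto
  have "pochhammer a n \<le> pochhammer b n \<and> (a > -1 \<or> b > 0 \<longrightarrow> pochhammer a n < pochhammer b n)"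
  proof (cases "a \<ge> 0")
    case True
    have "a * P \<le> a * Q" using True PQ by (rule mult_left_mono[rotated])
    also have "\<dots> < b * Q" using ab Q0 by simp
    finally show ?thesis by (simp add: eqs)
  next
    case False
    have "a * P \<le> 0" using False P0 by (simp add: mult_nonpos_nonneg)
    moreover have "b * Q \<ge> 0" using b Q0 by simp
    moreover have "a > -1 \<Longrightarrow> a * P < 0" using False P1 by (simp add: mult_neg_pos)
    moreover have "b > 0 \<Longrightarrow> b * Q > 0" using Q0 by simp
    ultimately show ?thesis unfolding eqs by linarith
  qed
  then show "pochhammer a n \<le> pochhammer b n"
    and "a > -1 \<or> b > 0 \<Longrightarrow> pochhammer a n < pochhammer b n" by blast+
qed

lemma rGamma_real_pos: "x > 0 \<Longrightarrow> rGamma x > 0" for x :: real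
  by (simp add: rGamma_inverse_Gamma Gamma_real_pos)

lemma rGamma_real_nonneg: "x \<ge> 0 \<Longrightarrow> rGamma x \<ge> 0" for x :: real
  using rGamma_real_pos[of x] by (cases "x = 0") auto

text \<open>The functional equation pulls the common factor \<open>R\<close> out of both sides and
  leaves the rising factorials \<open>P\<close> and \<open>Q\<close> to be compared.\<close>

lemma rGamma_cross_product:
  fixes \<mu> \<beta> :: real
  assumes mu: "\<mu> \<ge> -1" and beta: "\<beta> > 0" and mb: "\<mu> + \<beta> \<ge> 0" and kl: "k < l"
  shows "rGamma (\<mu> + real k) * rGamma (\<mu> + \<beta> + real l) \<le> rGamma (\<mu> + real l) * rGamma (\<mu> + \<beta> + real k)"
    and "\<mu> > -1 \<or> \<beta> \<noteq> 1 \<and> l \<ge> 2 \<Longrightarrow>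
      rGamma (\<mu> + real k) * rGamma (\<mu> + \<beta> + real l) < rGamma (\<mu> + real l) * rGamma (\<mu> + \<beta> + real k)"
proof -
  define P Q where "P = pochhammer (\<mu> + real k) (l - k)"
    and "Q = pochhammer (\<mu> + \<beta> + real k) (l - k)"
  define R where "R = rGamma (\<mu> + real l) * rGamma (\<mu> + \<beta> + real l)"
  have eqs: "rGamma (\<mu> + real k) = P * rGamma (\<mu> + real l)"
    "rGamma (\<mu> + \<beta> + real k) = Q * rGamma (\<mu> + \<beta> + real l)"
    using kl pochhammer_rGamma[of "\<mu> + real k" "l - k"]
      pochhammer_rGamma[of "\<mu> + \<beta> + real k" "l - k"]
    by (simp_all add: P_def Q_def add.assoc of_nat_diff)
  have l: "real l \<ge> 1" using kl by simp
  have ml: "rGamma (\<mu> + real l) \<ge> 0" using mu l by (intro rGamma_real_nonneg) linarith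
  have mbl: "rGamma (\<mu> + \<beta> + real l) > 0" using mb l by (intro rGamma_real_pos) linarith
  have "P \<le> Q" unfolding P_def Q_def
    by (rule pochhammer_mono_ge_minus_one(1)) (use mu beta mb kl in auto)
  then have "P * R \<le> Q * R" unfolding R_def using ml mbl by (intro mult_right_mono) auto
  then show "rGamma (\<mu> + real k) * rGamma (\<mu> + \<beta> + real l) \<le> rGamma (\<mu> + real l) * rGamma (\<mu> + \<beta> + real k)"
    by (simp add: eqs R_def mult_ac)
  assume strict: "\<mu> > -1 \<or> \<beta> \<noteq> 1 \<and> l \<ge> 2"
  \<comment> \<open>At \<open>\<mu> = -1\<close> the value \<open>l = 1\<close> would make
    \<open>R\<close> vanish, hence the condition \<open>l \<ge> 2\<close>.\<close>
  have "\<mu> + real l > 0" using strict mu l by auto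
  then have R0: "R > 0" unfolding R_def using mbl by (simp add: rGamma_real_pos)
  \<comment> \<open>If \<open>\<mu> = -1\<close>, then \<open>\<mu> + \<beta> \<ge> 0\<close> and
    \<open>\<beta> \<noteq> 1\<close> force \<open>\<beta> > 1\<close>.\<close>
  have "\<mu> + real k > -1 \<or> \<mu> + \<beta> + real k > 0"
    using strict mu mb by (cases "k = 0") auto
  then have "P < Q" unfolding P_def Q_def
    by (intro pochhammer_mono_ge_minus_one(2)) (use mu beta mb kl in auto)
  then have "P * R < Q * R" using R0 by simp
  then show "rGamma (\<mu> + real k) * rGamma (\<mu> + \<beta> + real l) < rGamma (\<mu> + real l) * rGamma (\<mu> + \<beta> + real k)"
    by (simp add: eqs R_def mult_ac)
qed

section \<open>Log-concavity and the signs of the coefficients\<close>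

text \<open>This is the decrease of the ratios \<open>g (Suc i) / g i\<close>, cleared of
  denominators. Where \<open>g j = 0\<close>, the absence of internal zeros makes the left side of
  the next inequality vanish.\<close>

lemma log_concave_cross:
  assumes nonneg: "\<forall>n. g n \<ge> 0" and logconc: "log_concave_seq g" and noint: "no_internal_zeros g"
    and ij: "i \<le> j"
  shows "g i * g (Suc j) \<le> g (Suc i) * g j"
  using ij
proof (induction j rule: dec_induct)
  case base
  show ?case by simp
next
  case (step j)
  show ?case
  proof (cases "g j = 0")
    case True
    then have "g (j + 2) = 0" using noint unfolding no_internal_zeros_def by blast
    then show ?thesis using nonneg by simp
  next
    case False
    then have gj: "g j > 0" using nonneg[rule_format, of j] by simp
    have "g j * g (Suc (Suc j)) \<le> (g (Suc j))\<^sup>2"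
      using logconc[unfolded log_concave_seq_def, rule_format, of "Suc j"] by simp
    then have "g i * (g j * g (Suc (Suc j))) \<le> g i * (g (Suc j))\<^sup>2"
      using nonneg by (intro mult_left_mono) auto
    also have "\<dots> = g i * g (Suc j) * g (Suc j)" by (simp add: power2_eq_square)
    also have "\<dots> \<le> g (Suc i) * g j * g (Suc j)" using step.IH nonneg by (intro mult_right_mono) auto
    finally have "g j * (g i * g (Suc (Suc j))) \<le> g j * (g (Suc i) * g (Suc j))" by (simp add: mult_ac)
    then show ?thesis using gj by simp
  qed
qed

text \<open>The arguments are written with \<open>Suc m - k\<close> and \<open>Suc m - Suc k\<close>
  so that the bracket is an increment of one sequence in \<open>k\<close>.\<close>

lemma lam_fps_nth:
  "fps_nth (lam_fps g \<beta> \<mu>) m = (\<Sum>k<Suc m. g k * g (m - k) *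
     (rGamma (\<mu> + real (Suc k)) * rGamma (\<mu> + \<beta> + real (Suc m - Suc k))
      - rGamma (\<mu> + real k) * rGamma (\<mu> + \<beta> + real (Suc m - k))))"
  unfolding lam_fps_def recip_gamma_fps_def fps_sub_nth fps_mult_nth sum_subtractf[symmetric]
  by (intro sum.cong) (auto simp: algebra_simps Suc_diff_le)

lemma lam_fps_nth_sign:
  fixes g :: "nat \<Rightarrow> real"
  assumes nonneg: "\<forall>n. g n \<ge> 0" and logconc: "log_concave_seq g" and noint: "no_internal_zeros g"
    and mu: "\<mu> \<ge> -1" and beta: "\<beta> > 0" and mb: "\<mu> + \<beta> \<ge> 0"
  shows "fps_nth (lam_fps g \<beta> \<mu>) m \<ge> 0"
    and "\<exists>k\<le>m. g k * g (m - k) \<noteq> 0 \<Longrightarrow> \<mu> > -1 \<or> (\<beta> \<noteq> 1 \<and> m > 0) \<Longrightarrow>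
      fps_nth (lam_fps g \<beta> \<mu>) m > 0"
proof -
  define N where "N = Suc m"
  \<comment> \<open>The weights are shifted by one and padded by zeros at 0 and
    \<open>N + 1\<close>; thus the first non-zero weight also counts as an increment.\<close>
  define e where "e j = (if 1 \<le> j \<and> j \<le> N then g (j - 1) * g (N - j) else 0)" for j
  define U where "U k = rGamma (\<mu> + real k) * rGamma (\<mu> + \<beta> + real (N - k))" for k
  define T where "T k = (e (Suc k) - e k) * (U (N - k) - U k)" for k
  have e0: "e 0 = 0" by (simp add: e_def)
  have sym: "e (Suc N - k) = e k" if "k \<le> Suc N" for k
    using that by (auto simp: e_def mult.commute intro!: arg_cong[where f = g] arg_cong2[where f = "(*)"])
  have enn: "e j \<ge> 0" for j using nonneg by (simp add: e_def)
  have "fps_nth (lam_fps g \<beta> \<mu>) m = (\<Sum>k<N. e (Suc k) * (U (Suc k) - U k))"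
    unfolding lam_fps_nth by (intro sum.cong) (auto simp: N_def e_def U_def)
  then have twice: "2 * fps_nth (lam_fps g \<beta> \<mu>) m = (\<Sum>k\<le>N. T k)"
    unfolding T_def using symmetric_summation_by_parts[OF e0 sym] by simp
  have e_mono: "e k \<le> e (Suc k)" if "k < N - k" for k
  proof (cases k)
    case 0
    then show ?thesis using e0 enn by simp
  next
    case (Suc i)
    have "g i * g (Suc (N - Suc k)) \<le> g (Suc i) * g (N - Suc k)"
      by (rule log_concave_cross[OF nonneg logconc noint]) (use that Suc in linarith)
    moreover have "Suc (N - Suc k) = N - k" using that by simp
    moreover have "Suc k \<le> N" using that by linarith
    ultimately show ?thesis using Suc by (simp add: e_def)
  qed
  have U_mono: "U k \<le> U (N - k)" if "k < N - k" for k
    using rGamma_cross_product(1)[OF mu beta mb that] that by (simp add: U_def)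
  have T_half: "T k \<ge> 0" if "k < N - k" for k
    using e_mono[OF that] U_mono[OF that] by (simp add: T_def)
  \<comment> \<open>Both factors of \<open>T\<close> change sign under the reflection. The fixed
    index \<open>N - k = k\<close>, if there is one, gives \<open>T k = 0\<close>.\<close>
  have T_refl: "T (N - k) = T k" if "k \<le> N" for k
    using that sym[of k] sym[of "Suc k"] by (simp add: T_def Suc_diff_le algebra_simps)
  have T_nonneg: "T k \<ge> 0" if "k \<le> N" for k
  proof -
    consider "k < N - k" | "N - k = k" | "N - k < N - (N - k)" using \<open>k \<le> N\<close> by linarith
    then show ?thesis
    proof cases
      case 2
      then show ?thesis by (simp add: T_def)
    qed (use T_half T_refl[OF \<open>k \<le> N\<close>] in metis)+
  qed
  have "(\<Sum>k\<le>N. T k) \<ge> 0" using T_nonneg by (intro sum_nonneg) auto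
  then show "fps_nth (lam_fps g \<beta> \<mu>) m \<ge> 0" using twice by simp
  assume ex: "\<exists>k\<le>m. g k * g (m - k) \<noteq> 0" and strict: "\<mu> > -1 \<or> (\<beta> \<noteq> 1 \<and> m > 0)"
  define k where "k = (LEAST k. e (Suc k) \<noteq> 0)"
  from ex obtain k0 where "k0 \<le> m" "g k0 * g (m - k0) \<noteq> 0" by blast
  then have k0: "e (Suc k0) \<noteq> 0" by (simp add: e_def N_def)
  have ek: "e (Suc k) \<noteq> 0" unfolding k_def by (rule LeastI[of _ k0]) (rule k0)
  have kN: "k < N" using ek by (auto simp: e_def split: if_splits)
  have min: "e (Suc j) = 0" if "j < k" for j using not_less_Least that unfolding k_def by blast
  have "e k = 0" using min[of "k - 1"] e0 by (cases k) auto
  \<comment> \<open>Otherwise the mirror image of \<open>k\<close> would be an earlier index with a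
    non-zero weight.\<close>
  have "k \<le> N - Suc k"
  proof (rule ccontr)
    assume "\<not> ?thesis"
    then have "e (Suc (N - Suc k)) = 0" by (intro min) auto
    moreover have "e (Suc (N - Suc k)) = e (Suc k)" using sym[of "Suc k"] kN by (simp add: Suc_diff_Suc)
    ultimately show False using ek by simp
  qed
  then have half: "k < N - k" using kN by simp
  \<comment> \<open>For \<open>m > 0\<close> one has \<open>N \<ge> 2\<close>, and the larger of the
    two parts \<open>k\<close> and \<open>N - k\<close> is then at least 2.\<close>
  have "\<mu> > -1 \<or> \<beta> \<noteq> 1 \<and> N - k \<ge> 2" using strict half by (auto simp: N_def)
  then have "U k < U (N - k)"
    using rGamma_cross_product(2)[OF mu beta mb half] half by (simp add: U_def)
  then have "T k > 0" using \<open>e k = 0\<close> ek enn[of "Suc k"] by (simp add: T_def)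
  then have "(\<Sum>k\<le>N. T k) > 0" using T_nonneg kN by (intro sum_pos2[of _ k]) auto
  then show "fps_nth (lam_fps g \<beta> \<mu>) m > 0" using twice by simp
qed

section \<open>Convergence of the series and of their products\<close>

text \<open>The ratios are bounded by the first one; convergence everywhere needs no more about
  \<open>g\<close>.\<close>

lemma log_concave_geometric_growth:
  assumes nonneg: "\<forall>n. g n \<ge> 0" and logconc: "log_concave_seq g" and noint: "no_internal_zeros g"
    and g0: "g 0 > 0"
  shows "g (Suc n) \<le> g 1 / g 0 * g n"
  using log_concave_cross[OF nonneg logconc noint, of 0 n] g0 by (simp add: field_simps)

text \<open>Ratio test: passing from \<open>n\<close> to \<open>n + 1\<close> divides the reciprocal
  gamma value by \<open>\<mu> + n\<close>, which eventually dominates the factor coming from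
  \<open>g\<close> and \<open>x\<close>.\<close>

lemma recip_gamma_summable:
  fixes g :: "nat \<Rightarrow> real"
  assumes nonneg: "\<forall>n. g n \<ge> 0" and ratio: "\<And>n. g (Suc n) \<le> q * g n"
  shows "summable (\<lambda>n. g n * x ^ n * rGamma (\<mu> + real n))"
proof -
  \<comment> \<open>From here on \<open>\<mu> + n\<close> is positive and at least twice
    \<open>\<bar>q\<bar> * \<bar>x\<bar>\<close>, whence the ratio 1/2.\<close>
  define N where "N = nat \<lceil>\<bar>\<mu>\<bar> + 2 * \<bar>q\<bar> * \<bar>x\<bar> + 1\<rceil>"
  show ?thesis
  proof (rule summable_ratio_test[where c = "1/2" and N = N])
    fix n assume "n \<ge> N"
    then have n: "real n \<ge> \<bar>\<mu>\<bar> + 2 * \<bar>q\<bar> * \<bar>x\<bar> + 1" unfolding N_def by linarith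
    define r where "r = \<bar>rGamma (\<mu> + real (Suc n))\<bar>"
    have "0 \<le> \<bar>q\<bar> * \<bar>x\<bar>" by simp
    then have p: "2 * (\<bar>q\<bar> * \<bar>x\<bar>) \<le> \<mu> + real n" "\<mu> + real n > 0" using n by linarith+
    have r: "\<bar>rGamma (\<mu> + real n)\<bar> = (\<mu> + real n) * r"
      using rGamma_plus1[of "\<mu> + real n"] p
      by (metis (no_types, lifting) abs_mult abs_of_pos add.assoc add.commute of_nat_Suc r_def)
    have g': "g (Suc n) \<le> \<bar>q\<bar> * g n"
      using ratio[of n] mult_right_mono[of q "\<bar>q\<bar>" "g n"] nonneg by fastforce
    have "norm (g (Suc n) * x ^ Suc n * rGamma (\<mu> + real (Suc n))) = g (Suc n) * (\<bar>x\<bar> ^ Suc n * r)"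
      using nonneg by (simp add: abs_mult power_abs r_def)
    also have "\<dots> \<le> \<bar>q\<bar> * g n * (\<bar>x\<bar> ^ Suc n * r)"
      using g' by (intro mult_right_mono) (auto simp: r_def)
    also have "\<dots> = (\<bar>q\<bar> * \<bar>x\<bar>) * (g n * \<bar>x\<bar> ^ n * r)" by simp
    also have "\<dots> \<le> ((\<mu> + real n) / 2) * (g n * \<bar>x\<bar> ^ n * r)"
      using p nonneg by (intro mult_right_mono) (auto simp: r_def)
    also have "\<dots> = 1/2 * norm (g n * x ^ n * rGamma (\<mu> + real n))"
      using nonneg r by (simp add: abs_mult power_abs)
    finally show "norm (g (Suc n) * x ^ Suc n * rGamma (\<mu> + real (Suc n)))
        \<le> 1/2 * norm (g n * x ^ n * rGamma (\<mu> + real n))" .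
  qed simp
qed

text \<open>A power series converging at \<open>\<bar>x\<bar> + 1\<close> converges absolutely at
  \<open>x\<close>.\<close>

lemma recip_gamma_summable_abs:
  fixes g :: "nat \<Rightarrow> real"
  assumes nonneg: "\<forall>n. g n \<ge> 0" and ratio: "\<And>n. g (Suc n) \<le> q * g n"
  shows "summable (\<lambda>n. \<bar>g n * x ^ n * rGamma (\<mu> + real n)\<bar>)"
proof -
  have "summable (\<lambda>n. g n * \<bar>x\<bar> ^ n * rGamma (\<mu> + real n))"
    by (rule recip_gamma_summable[OF assms])
  then have "summable (\<lambda>n. g n * rGamma (\<mu> + real n) * \<bar>x\<bar> ^ n)"
    by (simp add: mult_ac)
  then have *: "summable (\<lambda>n. g n * rGamma (\<mu> + real n) * y ^ n)" for y
    using recip_gamma_summable[OF assms, of y \<mu>] by (simp add: mult_ac)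
  have "summable (\<lambda>n. norm (g n * rGamma (\<mu> + real n) * x ^ n))"
    by (rule powser_insidea[OF *[of "\<bar>x\<bar> + 1"]]) simp
  then show ?thesis by (simp add: mult_ac)
qed

text \<open>Absolute convergence permits Cauchy products, which ties the formal coefficients to the
  function \<open>lam\<close>.\<close>

lemma lam_fps_sums:
  fixes g :: "nat \<Rightarrow> real"
  assumes nonneg: "\<forall>n. g n \<ge> 0" and ratio: "\<And>n. g (Suc n) \<le> q * g n"
  shows "(\<lambda>m. fps_nth (lam_fps g \<beta> \<mu>) m * x ^ m) sums lam g \<beta> \<mu> x"
proof -
  have prod: "(\<lambda>m. fps_nth (recip_gamma_fps g a * recip_gamma_fps g b) m * x ^ m) sums
      (recip_gamma_sum g a x * recip_gamma_sum g b x)" for a b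
  proof -
    have "(\<lambda>m. \<Sum>k\<le>m. (g k * x ^ k * rGamma (a + real k)) * (g (m - k) * x ^ (m - k) * rGamma (b + real (m - k))))
       sums (recip_gamma_sum g a x * recip_gamma_sum g b x)"
      unfolding recip_gamma_sum_def
      by (rule Cauchy_product_sums) (simp_all only: real_norm_def recip_gamma_summable_abs[OF assms])
    moreover have "(\<Sum>k\<le>m. (g k * x ^ k * rGamma (a + real k)) * (g (m - k) * x ^ (m - k) * rGamma (b + real (m - k))))
       = fps_nth (recip_gamma_fps g a * recip_gamma_fps g b) m * x ^ m" for m
      unfolding fps_mult_nth recip_gamma_fps_def sum_distrib_right atLeast0AtMost
    proof (rule sum.cong, simp)
      fix k assume "k \<in> {..m}"
      then have "x ^ m = x ^ k * x ^ (m - k)" by (simp flip: power_add)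
      then show "g k * x ^ k * rGamma (a + real k) * (g (m - k) * x ^ (m - k) * rGamma (b + real (m - k))) =
        fps_nth (Abs_fps (\<lambda>n. g n * rGamma (a + real n))) k *
        fps_nth (Abs_fps (\<lambda>n. g n * rGamma (b + real n))) (m - k) * x ^ m" by simp
    qed
    ultimately show ?thesis by simp
  qed
  show ?thesis unfolding lam_fps_def lam_def fps_sub_nth left_diff_distrib
    by (intro sums_diff prod)
qed

section \<open>Everywhere convergent power series with non-negative coefficients\<close>

text \<open>Termwise differentiation preserves the hypotheses, so the induction on the order runs
  over all \<open>a\<close> and \<open>f\<close> at once.\<close>

lemma absolutely_monotonic_powser:
  fixes a :: "nat \<Rightarrow> real"
  assumes "\<And>n. a n \<ge> 0" and "\<And>x. (\<lambda>n. a n * x ^ n) sums f x"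
  shows "absolutely_monotonic f"
proof -
  have "((deriv ^^ k) f) differentiable (at x) \<and> (deriv ^^ k) f x \<ge> 0" if "x > 0" for k x
    using assms
  proof (induction k arbitrary: a f)
    case 0
    have sm: "summable (\<lambda>n. a n * y ^ n)" for y using 0(2) sums_summable by blast
    have f: "f = (\<lambda>x. \<Sum>n. a n * x ^ n)" using 0(2) by (simp add: fun_eq_iff sums_iff)
    have "DERIV f x :> (\<Sum>n. diffs a n * x ^ n)" unfolding f
      by (rule termdiffs_strong_converges_everywhere[OF sm])
    moreover have "f x \<ge> 0" unfolding f using 0(1) \<open>x > 0\<close> by (intro suminf_nonneg sm) auto
    ultimately show ?case by (auto simp: real_differentiable_def)
  next
    case (Suc k)
    have sm: "summable (\<lambda>n. a n * y ^ n)" for y using Suc.prems(2) sums_summable by blast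
    have f: "f = (\<lambda>x. \<Sum>n. a n * x ^ n)" using Suc.prems(2) by (simp add: fun_eq_iff sums_iff)
    have "DERIV f y :> (\<Sum>n. diffs a n * y ^ n)" for y unfolding f
      by (rule termdiffs_strong_converges_everywhere[OF sm])
    then have df: "deriv f = (\<lambda>y. \<Sum>n. diffs a n * y ^ n)" by (auto intro!: DERIV_imp_deriv)
    have "summable (\<lambda>n. diffs a n * y ^ n)" for y by (rule termdiff_converges_all[OF sm])
    then have "(\<lambda>n. diffs a n * y ^ n) sums deriv f y" for y
      unfolding df by (rule summable_sums)
    moreover have "diffs a n \<ge> 0" for n using Suc.prems(1) by (simp add: diffs_def)
    ultimately show ?case
      using Suc.IH[of "diffs a" "deriv f"] by (simp add: funpow_Suc_right del: funpow.simps)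
  qed
  then show ?thesis by (simp add: absolutely_monotonic_def)
qed

text \<open>This is Hoelder's inequality for series: Young's inequality is applied to the normalised
  powers \<open>x ^ n / f x\<close> and \<open>y ^ n / f y\<close>, and summation with weights
  \<open>a n\<close> gives \<open>t + (1 - t) = 1\<close>. The zero series is treated apart because
  of the division.\<close>

lemma multiplicatively_convex_powser:
  fixes a :: "nat \<Rightarrow> real"
  assumes a: "\<And>n. a n \<ge> 0" and f: "\<And>x. (\<lambda>n. a n * x ^ n) sums f x"
  shows "multiplicatively_convex f"
proof -
  have f_nonneg: "f x \<ge> 0" if "x > 0" for x
    using a that by (intro sums_le[OF _ sums_zero f]) auto
  show ?thesis
  proof (cases "\<forall>n. a n = 0")
    case True
    then have "f x = 0" for x using f[of x] sums_unique2[OF sums_zero] by fastforce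
    then show ?thesis by (simp add: multiplicatively_convex_def)
  next
    case False
    then obtain n0 where n0: "a n0 > 0" using a by (metis less_eq_real_def)
    have f_pos: "f x > 0" if "x > 0" for x
    proof -
      have "(\<Sum>n. a n * x ^ n) > 0"
        by (rule suminf_pos2[where i = n0]) (use f a n0 that in \<open>auto simp: sums_iff\<close>)
      then show ?thesis using f[of x] by (simp add: sums_iff)
    qed
    have "f (x powr t * y powr (1 - t)) \<le> f x powr t * f y powr (1 - t)"
      if x: "x > 0" and y: "y > 0" and t: "t \<in> {0..1}" for x y t
    proof -
      define C where "C = f x powr t * f y powr (1 - t)"
      have C: "C > 0" using f_pos[OF x] f_pos[OF y] by (simp add: C_def)
      have "a n * (x powr t * y powr (1 - t)) ^ n \<le> C * (t / f x * (a n * x ^ n) + (1 - t) / f y * (a n * y ^ n))" for n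
      proof -
        have pw: "(z powr s) ^ n = (z ^ n) powr s" if "z > 0" for z s :: real
          using that by (simp add: powr_def ln_realpow exp_of_nat_mult[symmetric] mult_ac)
        have "(x ^ n / f x) powr t * (y ^ n / f y) powr (1 - t) \<le> t * (x ^ n / f x) + (1 - t) * (y ^ n / f y)"
          using t x y f_pos[OF x] f_pos[OF y] by (intro Youngs_inequality_0) auto
        moreover have "(x ^ n / f x) powr t * (y ^ n / f y) powr (1 - t) = (x powr t * y powr (1 - t)) ^ n / C"
          using x y f_pos[OF x] f_pos[OF y] by (simp add: C_def powr_divide power_mult_distrib pw)
        ultimately have "(x powr t * y powr (1 - t)) ^ n \<le> C * (t * (x ^ n / f x) + (1 - t) * (y ^ n / f y))"
          using C by (simp add: pos_divide_le_eq mult.commute)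
        from mult_left_mono[OF this a[of n]] show ?thesis by (simp add: algebra_simps)
      qed
      moreover have "(\<lambda>n. C * (t / f x * (a n * x ^ n) + (1 - t) / f y * (a n * y ^ n))) sums
          (C * (t / f x * f x + (1 - t) / f y * f y))"
        by (intro sums_mult sums_add f)
      ultimately have "f (x powr t * y powr (1 - t)) \<le> C * (t / f x * f x + (1 - t) / f y * f y)"
        by (intro sums_le[OF _ f])
      also have "\<dots> = C" using f_pos[OF x] f_pos[OF y] by simp
      finally show ?thesis by (simp add: C_def)
    qed
    then show ?thesis using f_nonneg by (simp add: multiplicatively_convex_def)
  qed
qed

section \<open>Positivity and continuity in the parameter \<open>\<mu>\<close>\<close>

lemma recip_gamma_sum_pos:
  fixes g :: "nat \<Rightarrow> real"
  assumes nonneg: "\<forall>n. g n \<ge> 0" and ratio: "\<And>n. g (Suc n) \<le> q * g n"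
    and g0: "g 0 > 0" and "x \<ge> 0" "\<mu> > 0"
  shows "recip_gamma_sum g \<mu> x > 0"
  unfolding recip_gamma_sum_def
proof (rule suminf_pos2[where i = 0])
  show "summable (\<lambda>n. g n * x ^ n * rGamma (\<mu> + real n))" by (rule recip_gamma_summable[OF nonneg ratio])
qed (use assms in \<open>auto intro!: mult_pos_pos mult_nonneg_nonneg rGamma_real_nonneg rGamma_real_pos\<close>)

text \<open>Weierstrass M-test on intervals bounded away from 0. Since
  \<open>rGamma (\<mu> + n)\<close> is \<open>rGamma \<mu>\<close> divided by a rising factorial
  that grows with \<open>\<mu>\<close>, a multiple of the absolute series at the left end
  \<open>a\<close> is a majorant.\<close>

lemma recip_gamma_sum_continuous:
  fixes g :: "nat \<Rightarrow> real"
  assumes nonneg: "\<forall>n. g n \<ge> 0" and ratio: "\<And>n. g (Suc n) \<le> q * g n"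
  shows "continuous_on {0<..} (\<lambda>\<mu>. recip_gamma_sum g \<mu> x)"
proof -
  have cont: "continuous_on {a<..<b} (\<lambda>\<mu>. recip_gamma_sum g \<mu> x)" if a: "a > 0" for a b :: real
  proof -
    have "continuous_on {a..b} (rGamma :: real \<Rightarrow> real)"
      by (intro continuous_intros)
    then have "bounded (rGamma ` {a..b})"
      by (intro compact_imp_bounded compact_continuous_image) auto
    then obtain B where "\<forall>y\<in>rGamma ` {a..b}. norm y \<le> B"
      unfolding bounded_iff by blast
    then have B: "\<bar>rGamma \<mu>\<bar> \<le> B" if "\<mu> \<in> {a..b}" for \<mu> using that by simp
    have ra: "rGamma a > 0" using a by (rule rGamma_real_pos)
    have bound: "norm (g n * x ^ n * rGamma (\<mu> + real n)) \<le> B / rGamma a * \<bar>g n * x ^ n * rGamma (a + real n)\<bar>"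
      if mu: "\<mu> \<in> {a<..<b}" for n \<mu>
    proof -
      have pa: "pochhammer a n > 0" using a by (rule pochhammer_pos)
      have "pochhammer a n \<le> pochhammer \<mu> n"
        unfolding pochhammer_prod using a mu by (intro prod_mono) auto
      then have "\<bar>rGamma (\<mu> + real n)\<bar> * pochhammer a n \<le> \<bar>rGamma (\<mu> + real n)\<bar> * pochhammer \<mu> n"
        by (intro mult_left_mono) auto
      also have "\<dots> = \<bar>rGamma \<mu>\<bar>"
        using mu a pochhammer_rGamma[of \<mu> n] pochhammer_pos[of \<mu> n] by (simp add: abs_mult)
      also have "\<dots> \<le> B" using B mu by auto
      finally have "\<bar>rGamma (\<mu> + real n)\<bar> \<le> B / pochhammer a n" using pa by (simp add: field_simps)
      also have "\<dots> = B / rGamma a * \<bar>rGamma (a + real n)\<bar>"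
        using pa ra a pochhammer_rGamma[of a n] rGamma_real_pos[of "a + real n"] by simp
      finally have "\<bar>rGamma (\<mu> + real n)\<bar> \<le> B / rGamma a * \<bar>rGamma (a + real n)\<bar>" .
      from mult_left_mono[OF this, of "\<bar>g n * x ^ n\<bar>"] show ?thesis
        by (simp add: abs_mult mult_ac)
    qed
    have "uniform_limit {a<..<b} (\<lambda>n \<mu>. \<Sum>i<n. g i * x ^ i * rGamma (\<mu> + real i))
       (\<lambda>\<mu>. recip_gamma_sum g \<mu> x) sequentially"
      unfolding recip_gamma_sum_def
      by (rule Weierstrass_m_test[where M = "\<lambda>n. B / rGamma a * \<bar>g n * x ^ n * rGamma (a + real n)\<bar>"])
         (use bound recip_gamma_summable_abs[OF assms] in \<open>auto intro!: summable_mult\<close>)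
    then show ?thesis
      by (rule uniform_limit_theorem[rotated])
         (auto intro!: always_eventually continuous_intros continuous_on_compose2[OF continuous_on_rGamma[of UNIV]])
  qed
  \<comment> \<open>Continuity is local, and \<open>\<mu>\<close> lies in the open interval from
    \<open>\<mu>/2\<close> to \<open>\<mu> + 1\<close>.\<close>
  have "isCont (\<lambda>\<mu>. recip_gamma_sum g \<mu> x) \<mu>" if "\<mu> > 0" for \<mu>
    using cont[of "\<mu>/2" "\<mu> + 1"] that by (simp add: continuous_on_eq_continuous_at)
  then show ?thesis by (intro continuous_at_imp_continuous_on) auto
qed

section \<open>Wright log-concavity and the properties of \<open>lam\<close>\<close>

theorem theorem2:
  fixes g :: "nat \<Rightarrow> real"
  assumes nonneg: "\<forall>n. g n \<ge> 0"
    and nontrivial: "\<exists>n. g n \<noteq> 0"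
    and logconc: "log_concave_seq g"
    and noint: "no_internal_zeros g"
  shows "(\<forall>\<mu> x. summable (\<lambda>n. g n * x ^ n * rGamma (\<mu> + real n))) \<and>
     (\<forall>x\<ge>0. strictly_discrete_Wright_log_concave_on {0<..} (\<lambda>\<mu>. recip_gamma_sum g \<mu> x)) \<and>
     (\<forall>\<mu> \<beta>. \<mu> \<ge> -1 \<longrightarrow> \<beta> > 0 \<longrightarrow> \<mu> + \<beta> \<ge> 0 \<longrightarrow>
        (\<forall>x. (\<lambda>m. fps_nth (lam_fps g \<beta> \<mu>) m * x ^ m) sums lam g \<beta> \<mu> x) \<and>
        (\<forall>m. fps_nth (lam_fps g \<beta> \<mu>) m \<ge> 0) \<and>
        (\<forall>m. (\<exists>k\<le>m. g k * g (m - k) \<noteq> 0) \<longrightarrow> \<mu> > -1 \<or> (\<beta> \<noteq> 1 \<and> m > 0) \<longrightarrow>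
              fps_nth (lam_fps g \<beta> \<mu>) m > 0) \<and>
        absolutely_monotonic (lam g \<beta> \<mu>) \<and>
        multiplicatively_convex (lam g \<beta> \<mu>))"
proof -
  \<comment> \<open>A zero at index 0 would spread to all indices.\<close>
  have g0: "g 0 > 0"
  proof -
    have "g 0 \<noteq> 0" using nontrivial noint unfolding no_internal_zeros_def by (metis add_0)
    then show ?thesis using nonneg by (metis less_eq_real_def)
  qed
  define q where "q = g 1 / g 0"
  have ratio: "g (Suc n) \<le> q * g n" for n
    unfolding q_def by (rule log_concave_geometric_growth[OF nonneg logconc noint g0])
  note sums = lam_fps_sums[OF nonneg ratio]
  note sign = lam_fps_nth_sign[OF nonneg logconc noint]
  have wright: "strictly_discrete_Wright_log_concave_on {0<..} (\<lambda>\<mu>. recip_gamma_sum g \<mu> x)"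
    if x: "x \<ge> 0" for x
  proof -
    let ?F = "\<lambda>\<mu>. recip_gamma_sum g \<mu> x"
    have pos: "?F \<mu> > 0" if "\<mu> > 0" for \<mu>
      using recip_gamma_sum_pos[OF nonneg ratio g0 x that] .
    have one: "?F \<mu> * ?F (\<mu> + s + 1) < ?F (\<mu> + 1) * ?F (\<mu> + s)" if "\<mu> > 0" "s > 0" for \<mu> s
    proof -
      have "(\<Sum>m. fps_nth (lam_fps g s \<mu>) m * x ^ m) > 0"
      \<comment> \<open>The constant term is strictly positive and does not depend on
        \<open>x\<close>, so \<open>x = 0\<close> is covered.\<close>
      proof (rule suminf_pos2[where i = 0])
        show "summable (\<lambda>m. fps_nth (lam_fps g s \<mu>) m * x ^ m)" using sums by (rule sums_summable)
        show "0 \<le> fps_nth (lam_fps g s \<mu>) m * x ^ m" for m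
          using sign(1)[of \<mu> s m] that x by simp
        show "0 < fps_nth (lam_fps g s \<mu>) 0 * x ^ 0"
          using sign(2)[of \<mu> s 0] that g0 by simp
      qed
      then show ?thesis using sums[of s \<mu> x] by (simp add: sums_iff lam_def)
    qed
    have "?F \<mu> * ?F (\<mu> + real h + s) < ?F (\<mu> + real h) * ?F (\<mu> + s)"
      if h: "h > 0" and "\<mu> > 0" "s > 0" for \<mu> s h
      using h
    proof (induction h rule: nat_induct_non_zero)
      case 1
      then show ?case using one[OF \<open>\<mu> > 0\<close> \<open>s > 0\<close>] by (simp add: add_ac)
    next
      case (Suc h)
      \<comment> \<open>Shift 1 at \<open>\<mu> + h\<close> gives \<open>A * D < C * B\<close>, and
        the induction hypothesis gives \<open>?F \<mu> * B < A * ?F (\<mu> + s)\<close>. Chaining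
        them leaves the common factor \<open>A\<close> to cancel.\<close>
      define A B C D where "A = ?F (\<mu> + real h)" and "B = ?F (\<mu> + s + real h)"
        and "C = ?F (\<mu> + real (Suc h))" and "D = ?F (\<mu> + real (Suc h) + s)"
      have p: "A > 0" "B > 0" "C > 0" "D > 0" "?F \<mu> > 0" "?F (\<mu> + s) > 0"
        unfolding A_def B_def C_def D_def using that by (auto intro!: pos add_pos_nonneg)
      have "A * D < C * B"
        using one[of "\<mu> + real h" s] that by (simp add: A_def B_def C_def D_def add_ac)
      then have "?F \<mu> * (A * D) < ?F \<mu> * (C * B)" using p by simp
      also have "\<dots> = C * (?F \<mu> * B)" by simp
      also have "\<dots> < C * (A * ?F (\<mu> + s))"
        using Suc.IH p by (intro mult_strict_left_mono) (simp_all add: A_def B_def add_ac)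
      finally have "A * (?F \<mu> * D) < A * (C * ?F (\<mu> + s))" by (simp add: mult_ac)
      then show ?case using p by (simp add: C_def D_def)
    qed
    then show ?thesis
      using pos recip_gamma_sum_continuous[OF nonneg ratio]
      by (simp add: strictly_discrete_Wright_log_concave_on_def)
  qed
  show ?thesis
  proof (intro conjI allI impI, goal_cases)
    case 1
    show ?case by (rule recip_gamma_summable[OF nonneg ratio])
  next
    case 2
    then show ?case by (rule wright)
  next
    case 3
    show ?case by (rule sums)
  next
    case 4
    then show ?case by (rule sign(1))
  next
    case 5
    then show ?case by (rule sign(2))
  next
    case 6
    show ?case by (rule absolutely_monotonic_powser[OF sign(1)[OF 6] sums])
  next
    case 7
    show ?case by (rule multiplicatively_convex_powser[OF sign(1)[OF 7] sums])
  qed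
qed

end
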